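(* Let $X$ be a poset and $K$ a field with $|K|>2$. Let $\lambda$ be a $|K|$-complete endomorphism of the Boolean algebra $\mathcal{P}(X)$, let $\psi:FI(X,K)\to J(FI(X,K))$ be a linear map with $\psi(\delta)=0$, and let $\varphi:FI(X,K)\to FI(X,K)$ be the unital linear invertibility preserver given by $$\varphi(\alpha)=\sum_{k\in K}k\,e_{\lambda(L_k(\alpha))}+\psi(\alpha).$$ Then $\varphi$ is bijective and strong if and only if both of the following hold: (1) $\lambda$ is an automorphism of the Boolean algebra $\mathcal{P}(X)$; (2) $\psi$ maps $J(FI(X,K))$ bijectively onto $J(FI(X,K))$.
   Context: The finitary incidence algebra $FI(X,K)$ of a poset $(X,\le)$ over a field $K$ is the $K$-space of formal sums $\alpha=\sum_{x\le y}\alpha_{xy}e_{xy}$ ($x,y\in X$, $\alpha_{xy}\in K$, $e_{xy}$ symbols) such that for all $x<y$ the set of pairs $(u,v)$ with $x\le u<v\le y$ and $\alpha_{uv}\neq 0$ is finite. The product is $\alpha\beta=\sum_{x\le y}\big(\sum_{x\le z\le y}\alpha_{xz}\beta_{zy}\big)e_{xy}$; it is a unital associative algebra with identity $\delta=\sum_{x\in X}e_{xx}$. Write $e_x=e_{xx}$ and, for $A\subseteq X$, $e_A=\sum_{x\in A}e_x$. Put $J(FI(X,K))=\{\alpha\in FI(X,K)\mid \alpha_{xx}=0\ \forall x\in X\}$ (this is the Jacobson radical). For $k\in K$, $L_k(\alpha)=\{x\in X\mid \alpha_{xx}=k\}$. For pairwise disjoint sets $B_k\subseteq X$ ($k\in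 K$), $\sum_{k\in K}k\,e_{B_k}$ denotes the element with zero off-diagonal coefficients whose $(x,x)$-coefficient is $k$ if $x\in B_k$ and $0$ if $x$ lies in no $B_k$. A map $\varphi:A\to A$ on a unital associative algebra $A$ is an invertibility preserver of $A$ if $\varphi(U(A))\subseteq U(A)$, where $U(A)$ is the group of units; it is unital if $\varphi(1_A)=1_A$. An invertibility preserver $\varphi$ of $A$ is strong if for all $a\in A$: $a\in U(A)\iff\varphi(a)\in U(A)$. Linear means $K$-linear. $\mathcal{P}(X)$ is the Boolean algebra of all subsets of $X$ under union, intersection and complement; endomorphisms of Boolean algebras preserve these operations and also $0=\emptyset$ and $1=X$. For a cardinal $\kappa$, an endomorphism $\lambda$ of $\mathcal{P}(X)$ is $\kappa$-complete if $\lambda(\bigcup_{i\in I}A_i)=\bigcup_{i\in I}\lambda(A_i)$ for every family $\{A_i\}_{i\in I}$ of subsets of $X$ with $|I|\le\kappa$. *)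

theory Defs
  imports Complex_Main "HOL-Library.Disjoint_Sets"
begin

unbundle cardinal_syntax

section \<open>The finitary incidence algebra\<close>

text \<open>The poset \<open>X\<close> is the type \<open>'a::order\<close>. A formal sum over the pairs \<open>x \<le> y\<close> is a function
  on all pairs that vanishes on the pairs with \<open>\<not> x \<le> y\<close>.\<close>

typedef (overloaded) ('a::order, 'k::field) FI =
  "{\<alpha> :: 'a \<Rightarrow> 'a \<Rightarrow> 'k.
      (\<forall>x y. \<not> x \<le> y \<longrightarrow> \<alpha> x y = 0) \<and>
      (\<forall>x y. x < y \<longrightarrow> finite {(u, v). x \<le> u \<and> u < v \<and> v \<le> y \<and> \<alpha> u v \<noteq> 0})}"
  morphisms coeff Abs_FI
  by (rule exI[of _ "\<lambda>_ _. 0"]) simp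

setup_lifting type_definition_FI

lemma coeff_eq_0: "\<not> x \<le> y \<Longrightarrow> coeff \<alpha> x y = 0"
  using coeff[of \<alpha>] by blast

lemma coeff_nonzero_le: "coeff \<alpha> x y \<noteq> 0 \<Longrightarrow> x \<le> y"
  using coeff_eq_0 by blast

lemma finite_support:
  "finite {(u, v). x \<le> u \<and> u < v \<and> v \<le> y \<and> coeff \<alpha> u v \<noteq> 0}"
proof (cases "x < y")
  case True
  then show ?thesis using coeff[of \<alpha>] by blast
next
  case False
  then have E: "{(u, v). x \<le> u \<and> u < v \<and> v \<le> y \<and> coeff \<alpha> u v \<noteq> 0} = {}"
    using order.strict_trans1 order.strict_trans2 by blast
  show ?thesis unfolding E by simp
qed

lemma FI_eqI: "(\<And>x y. x \<le> y \<Longrightarrow> coeff \<alpha> x y = coeff \<beta> x y) \<Longrightarrow> \<alpha> = \<beta>"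
  by (metis coeff_eq_0 coeff_inject ext)

lemma finite_middle: "finite {z. coeff \<alpha> x z \<noteq> 0 \<and> coeff \<beta> z y \<noteq> 0}"
proof -
  let ?S = "{(u, v). x \<le> u \<and> u < v \<and> v \<le> y \<and> coeff \<alpha> u v \<noteq> 0}"
  have "{z. coeff \<alpha> x z \<noteq> 0 \<and> coeff \<beta> z y \<noteq> 0} \<subseteq> insert x (snd ` ?S)"
  proof
    fix z assume z: "z \<in> {z. coeff \<alpha> x z \<noteq> 0 \<and> coeff \<beta> z y \<noteq> 0}"
    then have "x \<le> z" "z \<le> y" using coeff_nonzero_le by blast+
    then show "z \<in> insert x (snd ` ?S)"
      using z by (cases "z = x") (auto simp: image_iff intro!: exI[of _ x])
  qed
  then show ?thesis by (rule finite_subset) (simp add: finite_support)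
qed

instantiation FI :: (order, field) ring_1
begin

lift_definition zero_FI :: "('a, 'b) FI" is "\<lambda>_ _. 0"
  by simp

lift_definition one_FI :: "('a, 'b) FI" is "\<lambda>x y. if x = y then 1 else 0"
proof -
  have E: "{(u, v). (x::'a) \<le> u \<and> u < v \<and> v \<le> y \<and> (if u = v then 1 else (0::'b)) \<noteq> 0} = {}" for x y
    by auto
  show "(\<forall>(x::'a) y. \<not> x \<le> y \<longrightarrow> (if x = y then 1 else 0) = (0::'b)) \<and>
    (\<forall>x y. x < y \<longrightarrow>
      finite {(u, v). (x::'a) \<le> u \<and> u < v \<and> v \<le> y \<and> (if u = v then 1 else (0::'b)) \<noteq> 0})"
    unfolding E by auto
qed

lift_definition uminus_FI :: "('a, 'b) FI \<Rightarrow> ('a, 'b) FI" is "\<lambda>\<alpha> x y. - \<alpha> x y"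
  by simp

lift_definition plus_FI :: "('a, 'b) FI \<Rightarrow> ('a, 'b) FI \<Rightarrow> ('a, 'b) FI"
  is "\<lambda>\<alpha> \<beta> x y. \<alpha> x y + \<beta> x y"
proof (intro conjI allI impI)
  fix \<alpha> \<beta> :: "'a \<Rightarrow> 'a \<Rightarrow> 'b" and x y :: 'a
  let ?S = "\<lambda>\<gamma>. {(u, v). x \<le> u \<and> u < v \<and> v \<le> y \<and> \<gamma> u v \<noteq> 0}"
  assume A: "(\<forall>x y. \<not> x \<le> y \<longrightarrow> \<alpha> x y = 0) \<and>
      (\<forall>x y. x < y \<longrightarrow> finite {(u, v). x \<le> u \<and> u < v \<and> v \<le> y \<and> \<alpha> u v \<noteq> 0})"
    "(\<forall>x y. \<not> x \<le> y \<longrightarrow> \<beta> x y = 0) \<and>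
      (\<forall>x y. x < y \<longrightarrow> finite {(u, v). x \<le> u \<and> u < v \<and> v \<le> y \<and> \<beta> u v \<noteq> 0})"
  { assume "\<not> x \<le> y" then show "\<alpha> x y + \<beta> x y = 0" using A by simp }
  assume "x < y"
  then have "finite (?S \<alpha> \<union> ?S \<beta>)" using A by blast
  then show "finite (?S (\<lambda>x y. \<alpha> x y + \<beta> x y))"
    by (rule rev_finite_subset) auto
qed

lift_definition minus_FI :: "('a, 'b) FI \<Rightarrow> ('a, 'b) FI \<Rightarrow> ('a, 'b) FI"
  is "\<lambda>\<alpha> \<beta> x y. \<alpha> x y - \<beta> x y"
proof (intro conjI allI impI)
  fix \<alpha> \<beta> :: "'a \<Rightarrow> 'a \<Rightarrow> 'b" and x y :: 'a
  let ?S = "\<lambda>\<gamma>. {(u, v). x \<le> u \<and> u < v \<and> v \<le> y \<and> \<gamma> u v \<noteq> 0}"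
  assume A: "(\<forall>x y. \<not> x \<le> y \<longrightarrow> \<alpha> x y = 0) \<and>
      (\<forall>x y. x < y \<longrightarrow> finite {(u, v). x \<le> u \<and> u < v \<and> v \<le> y \<and> \<alpha> u v \<noteq> 0})"
    "(\<forall>x y. \<not> x \<le> y \<longrightarrow> \<beta> x y = 0) \<and>
      (\<forall>x y. x < y \<longrightarrow> finite {(u, v). x \<le> u \<and> u < v \<and> v \<le> y \<and> \<beta> u v \<noteq> 0})"
  { assume "\<not> x \<le> y" then show "\<alpha> x y - \<beta> x y = 0" using A by simp }
  assume "x < y"
  then have "finite (?S \<alpha> \<union> ?S \<beta>)" using A by blast
  then show "finite (?S (\<lambda>x y. \<alpha> x y - \<beta> x y))"
    by (rule rev_finite_subset) auto
qed

text \<open>The interval from \<open>x\<close> to \<open>y\<close> may be infinite, and \<^const>\<open>sum\<close> is \<open>0\<close> on infinite index sets. So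
  the sum is restricted to the nonzero terms, of which there are finitely many.\<close>

definition mult_coeff :: "('a \<Rightarrow> 'a \<Rightarrow> 'b) \<Rightarrow> ('a \<Rightarrow> 'a \<Rightarrow> 'b) \<Rightarrow> 'a \<Rightarrow> 'a \<Rightarrow> 'b" where
  "mult_coeff \<alpha> \<beta> x y = (\<Sum>z | x \<le> z \<and> z \<le> y \<and> \<alpha> x z \<noteq> 0 \<and> \<beta> z y \<noteq> 0. \<alpha> x z * \<beta> z y)"

lift_definition times_FI :: "('a, 'b) FI \<Rightarrow> ('a, 'b) FI \<Rightarrow> ('a, 'b) FI" is mult_coeff
proof (intro conjI allI impI)
  fix \<alpha> \<beta> :: "'a \<Rightarrow> 'a \<Rightarrow> 'b" and x y :: 'a
  let ?S = "\<lambda>\<gamma>. {(u, v). x \<le> u \<and> u < v \<and> v \<le> y \<and> \<gamma> u v \<noteq> 0}"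
  assume A: "(\<forall>x y. \<not> x \<le> y \<longrightarrow> \<alpha> x y = 0) \<and>
      (\<forall>x y. x < y \<longrightarrow> finite {(u, v). x \<le> u \<and> u < v \<and> v \<le> y \<and> \<alpha> u v \<noteq> 0})"
    "(\<forall>x y. \<not> x \<le> y \<longrightarrow> \<beta> x y = 0) \<and>
      (\<forall>x y. x < y \<longrightarrow> finite {(u, v). x \<le> u \<and> u < v \<and> v \<le> y \<and> \<beta> u v \<noteq> 0})"
  { assume "\<not> x \<le> y"
    then have E: "{z. x \<le> z \<and> z \<le> y \<and> \<alpha> x z \<noteq> 0 \<and> \<beta> z y \<noteq> 0} = {}" by (auto dest: order_trans)
    show "mult_coeff \<alpha> \<beta> x y = 0" unfolding mult_coeff_def E by simp }
  assume "x < y"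
  then have fin: "finite (?S \<alpha>)" "finite (?S \<beta>)" using A by blast+
  have "?S (mult_coeff \<alpha> \<beta>) \<subseteq> ?S \<alpha> \<union> ?S \<beta> \<union> fst ` ?S \<alpha> \<times> snd ` ?S \<beta>"
  proof
    fix p assume "p \<in> ?S (mult_coeff \<alpha> \<beta>)"
    then obtain u v where p: "p = (u, v)"
      and uv: "x \<le> u" "u < v" "v \<le> y" "mult_coeff \<alpha> \<beta> u v \<noteq> 0"
      by blast
    have "{z. u \<le> z \<and> z \<le> v \<and> \<alpha> u z \<noteq> 0 \<and> \<beta> z v \<noteq> 0} \<noteq> {}"
      using uv(4) unfolding mult_coeff_def by (metis sum.empty)
    then obtain z where z: "u \<le> z" "z \<le> v" "\<alpha> u z \<noteq> 0" "\<beta> z v \<noteq> 0"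
      by blast
    consider "z = u" | "z = v" | "u < z" "z < v" using z by fastforce
    then show "p \<in> ?S \<alpha> \<union> ?S \<beta> \<union> fst ` ?S \<alpha> \<times> snd ` ?S \<beta>"
    proof cases
      case 3
      then have "(u, z) \<in> ?S \<alpha>" "(z, v) \<in> ?S \<beta>" using z uv by auto
      then have "u \<in> fst ` ?S \<alpha>" "v \<in> snd ` ?S \<beta>"
        by (metis (no_types, lifting) fst_conv image_eqI, metis (no_types, lifting) snd_conv image_eqI)
      then show ?thesis using p by blast
    qed (use z uv p in auto)
  qed
  then show "finite (?S (mult_coeff \<alpha> \<beta>))"
    by (rule finite_subset) (simp add: fin)
qed

lemma coeff_times:
  assumes "finite S" "{z. coeff \<alpha> x z \<noteq> 0 \<and> coeff \<beta> z y \<noteq> 0} \<subseteq> S"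
  shows "coeff (\<alpha> * \<beta>) x y = (\<Sum>z\<in>S. coeff \<alpha> x z * coeff \<beta> z y)"
  unfolding times_FI.rep_eq mult_coeff_def
  by (rule sum.mono_neutral_left) (use assms coeff_nonzero_le in auto)

instance
proof
  fix a b c :: "('a, 'b) FI"
  show "a * b * c = a * (b * c)"
  proof (rule FI_eqI)
    fix x y :: 'a
    assume "x \<le> y"
    define T where "T \<gamma> = {(u, v). x \<le> u \<and> u < v \<and> v \<le> y \<and> coeff \<gamma> u v \<noteq> 0}" for \<gamma> :: "('a, 'b) FI"
    define S where "S = insert x (insert y (snd ` T a \<union> fst ` T c))"
    have S: "finite S"
      by (simp add: S_def T_def finite_support)
    have Sa: "w \<in> S" if "coeff a x w \<noteq> 0" "w \<le> y" for w
    proof (cases "x = w")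
      case False
      then have "(x, w) \<in> T a" using that coeff_nonzero_le[of a x w] by (auto simp: T_def)
      then show ?thesis by (force simp: S_def)
    qed (simp add: S_def)
    have Sc: "w \<in> S" if "coeff c w y \<noteq> 0" "x \<le> w" for w
    proof (cases "w = y")
      case False
      then have "(w, y) \<in> T c" using that coeff_nonzero_le[of c w y] by (auto simp: T_def)
      then show ?thesis by (force simp: S_def)
    qed (simp add: S_def)
    have le: "x \<le> z \<and> z \<le> y" if "z \<in> S" for z
      using that \<open>x \<le> y\<close> by (auto simp: S_def T_def)
    have ab: "coeff (a * b) x z = (\<Sum>w\<in>S. coeff a x w * coeff b w z)" if "z \<in> S" for z
      by (rule coeff_times[OF S]) (auto intro!: Sa intro: order_trans[OF coeff_nonzero_le conjunct2[OF le[OF that]]])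
    have bc: "coeff (b * c) z y = (\<Sum>w\<in>S. coeff b z w * coeff c w y)" if "z \<in> S" for z
      by (rule coeff_times[OF S]) (auto intro!: Sc intro: order_trans[OF conjunct1[OF le[OF that]] coeff_nonzero_le])
    have "coeff (a * b * c) x y = (\<Sum>z\<in>S. coeff (a * b) x z * coeff c z y)"
      by (rule coeff_times[OF S]) (auto intro!: Sc intro: coeff_nonzero_le)
    also have "\<dots> = (\<Sum>z\<in>S. \<Sum>w\<in>S. coeff a x w * coeff b w z * coeff c z y)"
      by (simp add: ab sum_distrib_right)
    also have "\<dots> = (\<Sum>w\<in>S. \<Sum>z\<in>S. coeff a x w * coeff b w z * coeff c z y)"
      by (rule sum.swap)
    also have "\<dots> = (\<Sum>w\<in>S. coeff a x w * coeff (b * c) w y)"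
      by (simp add: bc sum_distrib_left mult.assoc)
    also have "\<dots> = coeff (a * (b * c)) x y"
      by (rule coeff_times[OF S, symmetric]) (auto intro!: Sa intro: coeff_nonzero_le)
    finally show "coeff (a * b * c) x y = coeff (a * (b * c)) x y" .
  qed
  show "1 * a = a"
  proof (rule FI_eqI)
    fix x y :: 'a
    have "coeff (1 * a) x y = (\<Sum>z\<in>{x}. coeff 1 x z * coeff a z y)"
      by (rule coeff_times) (auto simp: one_FI.rep_eq split: if_splits)
    then show "coeff (1 * a) x y = coeff a x y" by (simp add: one_FI.rep_eq)
  qed
  show "a * 1 = a"
  proof (rule FI_eqI)
    fix x y :: 'a
    have "coeff (a * 1) x y = (\<Sum>z\<in>{y}. coeff a x z * coeff 1 z y)"
      by (rule coeff_times) (auto simp: one_FI.rep_eq split: if_splits)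
    then show "coeff (a * 1) x y = coeff a x y" by (simp add: one_FI.rep_eq)
  qed
  show "(a + b) * c = a * c + b * c"
  proof (rule FI_eqI)
    fix x y :: 'a
    let ?S = "{z. coeff a x z \<noteq> 0 \<and> coeff c z y \<noteq> 0} \<union> {z. coeff b x z \<noteq> 0 \<and> coeff c z y \<noteq> 0}"
    have S: "finite ?S" by (simp add: finite_middle)
    have "coeff ((a + b) * c) x y = (\<Sum>z\<in>?S. coeff (a + b) x z * coeff c z y)"
      by (rule coeff_times[OF S]) (auto simp: plus_FI.rep_eq)
    also have "\<dots> = (\<Sum>z\<in>?S. coeff a x z * coeff c z y) + (\<Sum>z\<in>?S. coeff b x z * coeff c z y)"
      by (simp add: plus_FI.rep_eq distrib_right sum.distrib)
    also have "\<dots> = coeff (a * c) x y + coeff (b * c) x y"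
      by (simp add: coeff_times[OF S])
    finally show "coeff ((a + b) * c) x y = coeff (a * c + b * c) x y"
      by (simp add: plus_FI.rep_eq)
  qed
  show "a * (b + c) = a * b + a * c"
  proof (rule FI_eqI)
    fix x y :: 'a
    let ?S = "{z. coeff a x z \<noteq> 0 \<and> coeff b z y \<noteq> 0} \<union> {z. coeff a x z \<noteq> 0 \<and> coeff c z y \<noteq> 0}"
    have S: "finite ?S" by (simp add: finite_middle)
    have "coeff (a * (b + c)) x y = (\<Sum>z\<in>?S. coeff a x z * coeff (b + c) z y)"
      by (rule coeff_times[OF S]) (auto simp: plus_FI.rep_eq)
    also have "\<dots> = (\<Sum>z\<in>?S. coeff a x z * coeff b z y) + (\<Sum>z\<in>?S. coeff a x z * coeff c z y)"
      by (simp add: plus_FI.rep_eq distrib_left sum.distrib)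
    also have "\<dots> = coeff (a * b) x y + coeff (a * c) x y"
      by (simp add: coeff_times[OF S])
    finally show "coeff (a * (b + c)) x y = coeff (a * b + a * c) x y"
      by (simp add: plus_FI.rep_eq)
  qed
  show "(0 :: ('a, 'b) FI) \<noteq> 1"
    by (simp add: coeff_inject[symmetric] fun_eq_iff zero_FI.rep_eq one_FI.rep_eq)
  show "a + b + c = a + (b + c)" "a + b = b + a" "0 + a = a" "- a + a = 0" "a - b = a + - b"
    by (simp_all add: coeff_inject[symmetric] fun_eq_iff plus_FI.rep_eq uminus_FI.rep_eq
        minus_FI.rep_eq zero_FI.rep_eq algebra_simps)
qed

end

lift_definition scale_FI :: "'k \<Rightarrow> ('a::order, 'k::field) FI \<Rightarrow> ('a, 'k) FI"
  is "\<lambda>c \<alpha> x y. c * \<alpha> x y"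
proof (intro conjI allI impI)
  fix c :: 'k and \<alpha> :: "'a \<Rightarrow> 'a \<Rightarrow> 'k" and x y :: 'a
  let ?S = "\<lambda>\<gamma>. {(u, v). x \<le> u \<and> u < v \<and> v \<le> y \<and> \<gamma> u v \<noteq> 0}"
  assume A: "(\<forall>x y. \<not> x \<le> y \<longrightarrow> \<alpha> x y = 0) \<and>
      (\<forall>x y. x < y \<longrightarrow> finite {(u, v). x \<le> u \<and> u < v \<and> v \<le> y \<and> \<alpha> u v \<noteq> 0})"
  { assume "\<not> x \<le> y" then show "c * \<alpha> x y = 0" using A by simp }
  assume "x < y"
  then have "finite (?S \<alpha>)" using A by blast
  then show "finite (?S (\<lambda>x y. c * \<alpha> x y))"
    by (rule rev_finite_subset) auto
qed

interpretation FI: vector_space "scale_FI :: 'k \<Rightarrow> ('a::order, 'k::field) FI \<Rightarrow> ('a, 'k) FI"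
proof
  fix a b :: 'k and \<alpha> \<beta> :: "('a, 'k) FI"
  show "scale_FI a (\<alpha> + \<beta>) = scale_FI a \<alpha> + scale_FI a \<beta>"
    by (rule FI_eqI) (simp add: plus_FI.rep_eq scale_FI.rep_eq distrib_left)
  show "scale_FI (a + b) \<alpha> = scale_FI a \<alpha> + scale_FI b \<alpha>"
    by (rule FI_eqI) (simp add: plus_FI.rep_eq scale_FI.rep_eq distrib_right)
  show "scale_FI a (scale_FI b \<alpha>) = scale_FI (a * b) \<alpha>"
    by (rule FI_eqI) (simp add: scale_FI.rep_eq mult.assoc)
  show "scale_FI 1 \<alpha> = \<alpha>"
    by (rule FI_eqI) (simp add: scale_FI.rep_eq)
qed

lemma scale_FI_mult:
  fixes \<alpha> \<beta> :: "('a::order, 'k::field) FI"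
  shows "scale_FI c \<alpha> * \<beta> = scale_FI c (\<alpha> * \<beta>)" "\<alpha> * scale_FI c \<beta> = scale_FI c (\<alpha> * \<beta>)"
proof -
  have S: "finite {z. coeff \<alpha> x z \<noteq> 0 \<and> coeff \<beta> z y \<noteq> 0}" (is "finite (?S x y)") for x y
    by (rule finite_middle)
  have 1: "coeff (scale_FI c \<alpha> * \<beta>) x y = (\<Sum>z\<in>?S x y. c * (coeff \<alpha> x z * coeff \<beta> z y))" for x y
    by (subst coeff_times[OF S[of x y]]) (auto simp: scale_FI.rep_eq mult.assoc)
  have 2: "coeff (\<alpha> * scale_FI c \<beta>) x y = (\<Sum>z\<in>?S x y. c * (coeff \<alpha> x z * coeff \<beta> z y))" for x y
    by (subst coeff_times[OF S[of x y]]) (auto simp: scale_FI.rep_eq mult.left_commute)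
  have 3: "coeff (scale_FI c (\<alpha> * \<beta>)) x y = (\<Sum>z\<in>?S x y. c * (coeff \<alpha> x z * coeff \<beta> z y))" for x y
    by (simp add: scale_FI.rep_eq coeff_times[OF S[of x y]] sum_distrib_left)
  show "scale_FI c \<alpha> * \<beta> = scale_FI c (\<alpha> * \<beta>)" "\<alpha> * scale_FI c \<beta> = scale_FI c (\<alpha> * \<beta>)"
    by (simp_all add: coeff_inject[symmetric] fun_eq_iff 1 2 3)
qed

abbreviation linear_FI :: "(('a::order, 'k::field) FI \<Rightarrow> ('a, 'k) FI) \<Rightarrow> bool" where
  "linear_FI \<equiv> Vector_Spaces.linear scale_FI scale_FI"

definition J :: "('a::order, 'k::field) FI set" where
  "J = {\<alpha>. \<forall>x. coeff \<alpha> x x = 0}"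

definition L :: "'k \<Rightarrow> ('a::order, 'k::field) FI \<Rightarrow> 'a set" where
  "L k \<alpha> = {x. coeff \<alpha> x x = k}"

text \<open>The element \<open>\<Sum>\<^sub>k k e\<^bsub>B k\<^esub>\<close> for a pairwise disjoint family \<open>B\<close>: for each \<open>x\<close> the sum below has
  at most one term.\<close>

lift_definition diag_sum :: "('k \<Rightarrow> 'a set) \<Rightarrow> ('a::order, 'k::field) FI"
  is "\<lambda>B x y. if x = y then \<Sum>k | x \<in> B k. k else 0"
proof (intro conjI allI impI)
  fix B :: "'k \<Rightarrow> 'a set" and x y :: 'a
  { assume "\<not> x \<le> y" then show "(if x = y then \<Sum>k | x \<in> B k. k else 0) = 0" by auto }
  have "{(u, v). x \<le> u \<and> u < v \<and> v \<le> y \<and> (if u = v then \<Sum>k | u \<in> B k. k else 0) \<noteq> 0} = {}"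
    by auto
  then show "finite {(u, v). x \<le> u \<and> u < v \<and> v \<le> y \<and> (if u = v then \<Sum>k | u \<in> B k. k else 0) \<noteq> 0}"
    by simp
qed

lemma coeff_diag_sum:
  assumes "disjoint_family_on B UNIV"
  shows "x \<noteq> y \<Longrightarrow> coeff (diag_sum B) x y = 0"
    and "x \<in> B k \<Longrightarrow> coeff (diag_sum B) x x = k"
    and "(\<And>k. x \<notin> B k) \<Longrightarrow> coeff (diag_sum B) x x = 0"
proof -
  show "coeff (diag_sum B) x x = k" if "x \<in> B k"
  proof -
    have "{k. x \<in> B k} = {k}" using that assms by (auto simp: disjoint_family_on_def)
    then show ?thesis by (simp add: diag_sum.rep_eq)
  qed
qed (auto simp: diag_sum.rep_eq)

section \<open>Invertibility preservers\<close>

definition unit_group :: "'a::monoid_mult set" where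
  "unit_group = {a. \<exists>b. a * b = 1 \<and> b * a = 1}"

definition invertibility_preserver :: "('a::monoid_mult \<Rightarrow> 'a) \<Rightarrow> bool" where
  "invertibility_preserver \<phi> \<longleftrightarrow> \<phi> ` unit_group \<subseteq> unit_group"

definition unital :: "('a::monoid_mult \<Rightarrow> 'a) \<Rightarrow> bool" where
  "unital \<phi> \<longleftrightarrow> \<phi> 1 = 1"

definition strong_invertibility_preserver :: "('a::monoid_mult \<Rightarrow> 'a) \<Rightarrow> bool" where
  "strong_invertibility_preserver \<phi> \<longleftrightarrow>
     invertibility_preserver \<phi> \<and> (\<forall>a. a \<in> unit_group \<longleftrightarrow> \<phi> a \<in> unit_group)"

section \<open>Endomorphisms of Boolean algebras\<close>

definition boolean_endomorphism :: "('b::boolean_algebra \<Rightarrow> 'b) \<Rightarrow> bool" where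
  "boolean_endomorphism f \<longleftrightarrow>
     (\<forall>a b. f (sup a b) = sup (f a) (f b)) \<and> (\<forall>a b. f (inf a b) = inf (f a) (f b)) \<and>
     (\<forall>a. f (- a) = - f a) \<and> f bot = bot \<and> f top = top"

definition boolean_automorphism :: "('b::boolean_algebra \<Rightarrow> 'b) \<Rightarrow> bool" where
  "boolean_automorphism f \<longleftrightarrow> boolean_endomorphism f \<and> bij f"

text \<open>The cardinal \<open>\<kappa>\<close> is a relation on \<open>'c\<close>, so every index set of size at most \<open>\<kappa>\<close> is in bijection
  with a subset of \<open>'c\<close>. The lemma below covers index sets of any type.\<close>

definition complete_map :: "'c rel \<Rightarrow> ('a set \<Rightarrow> 'a set) \<Rightarrow> bool" where
  "complete_map \<kappa> f \<longleftrightarrow>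
     (\<forall>(I :: 'c set) A. |I| \<le>o \<kappa> \<longrightarrow> f (\<Union>i\<in>I. A i) = (\<Union>i\<in>I. f (A i)))"

lemma complete_map_family:
  fixes \<kappa> :: "'c rel" and I :: "'i set"
  assumes f: "complete_map \<kappa> f" and \<kappa>: "Card_order \<kappa>" and I: "|I| \<le>o \<kappa>"
  shows "f (\<Union>i\<in>I. A i) = (\<Union>i\<in>I. f (A i))"
proof -
  have "|I| \<le>o |Field \<kappa>|"
    using I \<kappa> card_of_Field_ordIso ordIso_symmetric ordLeq_ordIso_trans by blast
  then obtain g where g: "inj_on g I" "g ` I \<subseteq> Field \<kappa>"
    by (auto simp: card_of_ordLeq[symmetric])
  have "|g ` I| \<le>o \<kappa>"
    by (rule ordLeq_transitive[OF card_of_image I])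
  then have "f (\<Union>j\<in>g ` I. A (inv_into I g j)) = (\<Union>j\<in>g ` I. f (A (inv_into I g j)))"
    using f unfolding complete_map_def by (elim allE impE)
  then show ?thesis using g(1) by simp
qed

end

theory Submission
  imports Defs
begin

text \<open>An element \<open>\<alpha>\<close> is a unit iff its diagonal has no zero: after scaling, \<open>\<alpha> = 1 - \<eta>\<close> with \<open>\<eta> \<in> J\<close>,
  and on each interval only finitely many powers of \<open>\<eta>\<close> survive, so the geometric series inverts
  \<open>\<alpha>\<close>. Completeness of \<open>\<Lambda>\<close> gives \<open>L k (\<phi> \<alpha>) = \<Lambda> (L k \<alpha>)\<close> for all \<open>k\<close>. Hence \<open>\<phi>\<close> is strong iff
  \<open>\<Lambda>\<close> has trivial kernel, \<open>\<phi>\<close> reaches all diagonals iff \<open>\<Lambda>\<close> is onto, and what remains is the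
  restriction of \<open>\<phi>\<close> to \<open>J\<close>, which is \<open>\<psi>\<close>.\<close>

section \<open>Units of the finitary incidence algebra\<close>

lemma coeff_times_diag: "coeff (\<alpha> * \<beta>) x x = coeff \<alpha> x x * coeff \<beta> x x"
  by (subst coeff_times[of "{x}"]) (auto dest!: coeff_nonzero_le)

lemma coeff_sum: "coeff (sum f A) x y = (\<Sum>i\<in>A. coeff (f i) x y)"
  by (induction A rule: infinite_finite_induct) (auto simp: zero_FI.rep_eq plus_FI.rep_eq)

text \<open>Multiplication is local: a coefficient at \<open>(x, y)\<close> only sees the factors on
  the interval from \<open>x\<close> to \<open>y\<close>. An inverse glued from local pieces can
  thus be replaced by a single piece when one coefficient is checked.\<close>

lemma coeff_times_cong:
  assumes "\<And>z. x \<le> z \<Longrightarrow> z \<le> y \<Longrightarrow> coeff \<alpha> x z = coeff \<alpha>' x z"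
    and "\<And>z. x \<le> z \<Longrightarrow> z \<le> y \<Longrightarrow> coeff \<beta> z y = coeff \<beta>' z y"
  shows "coeff (\<alpha> * \<beta>) x y = coeff (\<alpha>' * \<beta>') x y"
  unfolding times_FI.rep_eq mult_coeff_def by (rule sum.cong) (use assms in auto)

definition support_within :: "('a::order, 'k::field) FI \<Rightarrow> 'a \<Rightarrow> 'a \<Rightarrow> ('a \<times> 'a) set" where
  "support_within \<alpha> x y = {(u, v). x \<le> u \<and> u < v \<and> v \<le> y \<and> coeff \<alpha> u v \<noteq> 0}"

lemma finite_support_within: "finite (support_within \<alpha> x y)"
  unfolding support_within_def by (rule finite_support)

lemma support_within_mono:
  "x \<le> u \<Longrightarrow> v \<le> y \<Longrightarrow> support_within \<alpha> u v \<subseteq> support_within \<alpha> x y"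
  unfolding support_within_def using order_trans by blast

text \<open>A nonzero coefficient of \<eta>^n comes from a chain of n strict steps with nonzero
  \<eta>-coefficients. Splitting off the first step (x, z) strictly shrinks the support, since (x,
  z) does not lie above z.\<close>

lemma power_coeff_nonzero_bound:
  assumes "\<eta> \<in> J" "coeff (\<eta> ^ n) x y \<noteq> 0"
  shows "n \<le> card (support_within \<eta> x y)"
  using assms(2)
proof (induction n arbitrary: x)
  case (Suc n)
  have "{z. coeff \<eta> x z \<noteq> 0 \<and> coeff (\<eta> ^ n) z y \<noteq> 0} \<noteq> {}"
    using Suc.prems coeff_times[of "{}" \<eta> x "\<eta> ^ n" y] by auto
  then obtain z where z: "coeff \<eta> x z \<noteq> 0" "coeff (\<eta> ^ n) z y \<noteq> 0" by blast
  then have "x < z" "z \<le> y"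
    using assms(1) coeff_nonzero_le[of \<eta> x z] coeff_nonzero_le[of _ z y]
    by (auto simp: J_def order.strict_iff_order)
  then have "(x, z) \<in> support_within \<eta> x y - support_within \<eta> z y"
    using z by (auto simp: support_within_def)
  then have "support_within \<eta> z y \<subset> support_within \<eta> x y"
    using support_within_mono[of x z y y \<eta>] less_imp_le[OF \<open>x < z\<close>] by auto
  then have "card (support_within \<eta> z y) < card (support_within \<eta> x y)"
    by (rule psubset_card_mono[OF finite_support_within])
  then show ?case using Suc.IH[OF z(2)] by simp
qed simp

lemma geometric_sum_times:
  fixes a :: "'r::ring_1"
  shows "(1 - a) * (\<Sum>i<n. a ^ i) = 1 - a ^ n" "(\<Sum>i<n. a ^ i) * (1 - a) = 1 - a ^ n"
proof -
  show "(1 - a) * (\<Sum>i<n. a ^ i) = 1 - a ^ n"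
    by (induction n) (simp_all add: distrib_left left_diff_distrib)
  show "(\<Sum>i<n. a ^ i) * (1 - a) = 1 - a ^ n"
  proof (induction n)
    case (Suc n)
    have "a ^ n * (1 - a) = a ^ n - a ^ Suc n"
      by (simp add: right_diff_distrib power_commutes)
    then show ?case using Suc by (simp add: distrib_right del: power_Suc)
  qed simp
qed

lemma one_minus_J_unit:
  assumes "\<eta> \<in> J"
  shows "1 - \<eta> \<in> unit_group"
proof -
  \<comment> \<open>The infinite geometric series is built one coefficient at a time:
    \<open>b x y\<close> is read off the truncation \<open>G (N x y)\<close>. The power with
    exponent \<open>N x y\<close> may still survive at (x, y), hence the \<open>Suc\<close> in
    \<open>G\<close>.\<close>
  define N where "N x y = card (support_within \<eta> x y)" for x y
  define G where "G n = (\<Sum>i<Suc n. \<eta> ^ i)" for n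
  define b where "b x y = coeff (G (N x y)) x y" for x y
  \<comment> \<open>A truncation chosen for a larger interval only adds powers that vanish at (u,
    v).\<close>
  have b_eq: "b u v = coeff (G (N x y)) u v" if "x \<le> u" "v \<le> y" for x y u v
  proof -
    have "N u v \<le> N x y"
      unfolding N_def by (intro card_mono finite_support_within support_within_mono that)
    moreover have "coeff (\<eta> ^ i) u v = 0" if "N u v < i" for i
      using power_coeff_nonzero_bound[OF assms, of i u v] that by (force simp: N_def)
    ultimately show ?thesis
      unfolding b_def G_def coeff_sum by (intro sum.mono_neutral_left) auto
  qed
  have "\<not> x \<le> y \<longrightarrow> b x y = 0" for x y
    by (simp add: b_def coeff_eq_0)
  \<comment> \<open>On each interval \<open>b\<close> agrees with one element of the algebra and
    inherits its finite support.\<close>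
  moreover have "finite {(u, v). x \<le> u \<and> u < v \<and> v \<le> y \<and> b u v \<noteq> 0}" for x y
    by (rule finite_subset[OF _ finite_support[of x y "G (N x y)"]]) (auto simp: b_eq[of x _ _ y])
  ultimately have coeff_b: "coeff (Abs_FI b) = b"
    by (intro Abs_FI_inverse) auto
  have top_power: "coeff (1 - \<eta> ^ Suc (N x y)) x y = coeff 1 x y" for x y
    using power_coeff_nonzero_bound[OF assms, of "Suc (N x y)" x y]
    by (auto simp: minus_FI.rep_eq N_def)
  have "(1 - \<eta>) * Abs_FI b = 1"
  proof (rule FI_eqI)
    fix x y :: 'a
    have "coeff ((1 - \<eta>) * Abs_FI b) x y = coeff ((1 - \<eta>) * G (N x y)) x y"
      by (rule coeff_times_cong) (auto simp: coeff_b b_eq)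
    also have "(1 - \<eta>) * G (N x y) = 1 - \<eta> ^ Suc (N x y)"
      unfolding G_def by (rule geometric_sum_times(1))
    finally show "coeff ((1 - \<eta>) * Abs_FI b) x y = coeff 1 x y" by (simp only: top_power)
  qed
  moreover have "Abs_FI b * (1 - \<eta>) = 1"
  proof (rule FI_eqI)
    fix x y :: 'a
    have "coeff (Abs_FI b * (1 - \<eta>)) x y = coeff (G (N x y) * (1 - \<eta>)) x y"
      by (rule coeff_times_cong) (auto simp: coeff_b b_eq)
    also have "G (N x y) * (1 - \<eta>) = 1 - \<eta> ^ Suc (N x y)"
      unfolding G_def by (rule geometric_sum_times(2))
    finally show "coeff (Abs_FI b * (1 - \<eta>)) x y = coeff 1 x y" by (simp only: top_power)
  qed
  ultimately show ?thesis unfolding unit_group_def by blast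
qed

definition diag :: "('a \<Rightarrow> 'k) \<Rightarrow> ('a::order, 'k::field) FI" where
  "diag f = diag_sum (\<lambda>k. {x. f x = k})"

lemma coeff_diag: "coeff (diag f) x y = (if x = y then f x else 0)"
  by (simp add: diag_def diag_sum.rep_eq)

lemma diag_mult_inverse:
  assumes "\<And>x. f x \<noteq> 0"
  shows "diag f * diag (\<lambda>x. inverse (f x)) = 1"
proof (rule FI_eqI)
  fix x y :: 'a
  show "coeff (diag f * diag (\<lambda>x. inverse (f x))) x y = coeff 1 x y"
    by (subst coeff_times[of "{x}"]) (auto simp: coeff_diag one_FI.rep_eq assms)
qed

lemma unit_group_mult:
  assumes "a \<in> unit_group" "b \<in> unit_group"
  shows "a * b \<in> unit_group"
proof -
  obtain a' b' where "a * a' = 1" "a' * a = 1" "b * b' = 1" "b' * b = 1"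
    using assms unfolding unit_group_def by blast
  then have "(a * b) * (b' * a') = 1" "(b' * a') * (a * b) = 1"
    by (metis mult.assoc mult_1_left)+
  then show ?thesis unfolding unit_group_def by blast
qed

text \<open>Diagonals multiply entrywise, which forces nonzero entries in a unit. The criterion is
  phrased with \<open>L 0\<close> because \<phi> acts on level sets through \<Lambda>.\<close>

lemma unit_iff_L0_empty: "\<alpha> \<in> unit_group \<longleftrightarrow> L 0 \<alpha> = {}"
proof
  assume "\<alpha> \<in> unit_group"
  then obtain \<beta> where "\<alpha> * \<beta> = 1" unfolding unit_group_def by blast
  then have "coeff \<alpha> x x * coeff \<beta> x x = 1" for x
    by (simp add: coeff_times_diag[symmetric] one_FI.rep_eq)
  then show "L 0 \<alpha> = {}" unfolding L_def by (metis (mono_tags) empty_Collect_eq mult_zero_left zero_neq_one)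
next
  assume "L 0 \<alpha> = {}"
  then have nz: "coeff \<alpha> x x \<noteq> 0" for x by (auto simp: L_def)
  define d where "d = diag (\<lambda>x. coeff \<alpha> x x)"
  define d' where "d' = diag (\<lambda>x. inverse (coeff \<alpha> x x))"
  have dd': "d * d' = 1" and d'd: "d' * d = 1"
    using diag_mult_inverse[of "\<lambda>x. coeff \<alpha> x x"]
      diag_mult_inverse[of "\<lambda>x. inverse (coeff \<alpha> x x)"] nz
    by (simp_all add: d_def d'_def)
  have "1 - d' * \<alpha> \<in> J"
    using nz by (simp add: J_def minus_FI.rep_eq one_FI.rep_eq coeff_times_diag d'_def coeff_diag)
  then have "1 - (1 - d' * \<alpha>) \<in> unit_group" by (rule one_minus_J_unit)
  then have "d' * \<alpha> \<in> unit_group" by simp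
  moreover have "d \<in> unit_group" using dd' d'd unfolding unit_group_def by blast
  ultimately have "d * (d' * \<alpha>) \<in> unit_group" by (rule unit_group_mult[rotated])
  then show "\<alpha> \<in> unit_group" by (simp add: mult.assoc[symmetric] dd')
qed

lemma J_iff_L0: "\<alpha> \<in> J \<longleftrightarrow> L 0 \<alpha> = UNIV"
  by (auto simp: J_def L_def)

lemma L_diag: "L k (diag f) = {x. f x = k}"
  by (simp add: L_def coeff_diag)

lemma L_zero: "L k 0 = (if k = 0 then UNIV else {})"
  by (auto simp: L_def zero_FI.rep_eq)

text \<open>The level sets determine the diagonal, so they classify elements modulo
  \<open>J\<close>.\<close>

lemma diff_in_J_iff: "\<alpha> - \<beta> \<in> J \<longleftrightarrow> (\<forall>k. L k \<alpha> = L k \<beta>)"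
  by (auto simp: J_def L_def minus_FI.rep_eq set_eq_iff)

section \<open>Boolean endomorphisms and the diagonal\<close>

text \<open>If a and b have equal images, f sends the difference of a and b to \<open>bot\<close>,
  so a \<le> b; then exchange a and b.\<close>

lemma boolean_endomorphism_inj:
  assumes "boolean_endomorphism f" and "\<And>a. f a = bot \<Longrightarrow> a = bot"
  shows "inj f"
proof (rule injI)
  have le: "a \<le> b" if "f a = f b" for a b
  proof -
    have "f (inf a (- b)) = bot"
      using assms(1) that by (simp add: boolean_endomorphism_def)
    then have "inf a (- b) = bot" by (rule assms(2))
    then show ?thesis by (simp add: inf_shunt)
  qed
  fix a b assume "f a = f b"
  then show "a = b" using le[of a b] le[of b a] by (simp add: order.antisym)
qed

lemma complete_map_Union_range:
  fixes A :: "'k \<Rightarrow> 'a set"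
  assumes "complete_map |UNIV :: 'k set| f"
  shows "f (\<Union>k. A k) = (\<Union>k. f (A k))"
  using assms ordLeq_refl[OF card_of_Card_order] unfolding complete_map_def by blast

text \<open>Points outside every \<open>B k\<close> would get the default coefficient 0 and enlarge
  \<open>L 0\<close>; the covering hypothesis excludes them.\<close>

lemma L_diag_sum:
  assumes "disjoint_family B" "(\<Union>k. B k) = UNIV"
  shows "L k (diag_sum B) = B k"
proof -
  have "coeff (diag_sum B) x x = k \<longleftrightarrow> x \<in> B k" for x
  proof -
    obtain j where "x \<in> B j" using assms(2) by blast
    then show ?thesis
      using assms(1) coeff_diag_sum(2)[OF assms(1), of x] by (auto simp: disjoint_family_on_def)
  qed
  then show ?thesis by (auto simp: L_def)
qed

theorem corollary2p15:
  fixes \<Lambda> :: "'a::order set \<Rightarrow> 'a set"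
    and \<psi> \<phi> :: "('a, 'k::field) FI \<Rightarrow> ('a, 'k) FI"
  assumes "finite (UNIV :: 'k set) \<Longrightarrow> card (UNIV :: 'k set) > 2"
    and "boolean_endomorphism \<Lambda>"
    and "complete_map |UNIV :: 'k set| \<Lambda>"
    and "linear_FI \<psi>" and "range \<psi> \<subseteq> J" and "\<psi> 1 = 0"
    and "unital \<phi>" and "linear_FI \<phi>" and "invertibility_preserver \<phi>"
    and "\<And>\<alpha>. \<phi> \<alpha> = diag_sum (\<lambda>k. \<Lambda> (L k \<alpha>)) + \<psi> \<alpha>"
  shows "bij \<phi> \<and> strong_invertibility_preserver \<phi> \<longleftrightarrow>
    boolean_automorphism \<Lambda> \<and> bij_betw \<psi> J J"
proof -
  have \<Lambda>_empty: "\<Lambda> {} = {}" and \<Lambda>_UNIV: "\<Lambda> UNIV = UNIV"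
    and \<Lambda>_Int: "\<And>A B. \<Lambda> (A \<inter> B) = \<Lambda> A \<inter> \<Lambda> B"
    using assms(2) by (auto simp: boolean_endomorphism_def)
  have \<psi>_J: "\<psi> \<alpha> \<in> J" for \<alpha> using assms(5) by blast
  have disj: "disjoint_family (\<lambda>k. \<Lambda> (L k \<alpha>))" for \<alpha> :: "('a, 'k) FI"
  proof -
    have "\<Lambda> (L k \<alpha>) \<inter> \<Lambda> (L j \<alpha>) = {}" if "k \<noteq> j" for k j
    proof -
      have "L k \<alpha> \<inter> L j \<alpha> = {}" using that by (auto simp: L_def)
      then show ?thesis by (simp add: \<Lambda>_Int[symmetric] \<Lambda>_empty)
    qed
    then show ?thesis by (auto simp: disjoint_family_on_def)
  qed
  \<comment> \<open>Completeness enters here: the level sets form a family indexed by the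
    field.\<close>
  have cover: "(\<Union>k. \<Lambda> (L k \<alpha>)) = UNIV" for \<alpha> :: "('a, 'k) FI"
  proof -
    have "(\<Union>k. L k \<alpha>) = UNIV" by (auto simp: L_def)
    then show ?thesis
      using complete_map_Union_range[OF assms(3), of "\<lambda>k. L k \<alpha>"] \<Lambda>_UNIV by simp
  qed
  have L_\<phi>: "L k (\<phi> \<alpha>) = \<Lambda> (L k \<alpha>)" for k \<alpha>
  proof -
    have "\<phi> \<alpha> - diag_sum (\<lambda>k. \<Lambda> (L k \<alpha>)) \<in> J" by (simp add: assms(10) \<psi>_J)
    then show ?thesis unfolding diff_in_J_iff by (simp add: L_diag_sum[OF disj cover])
  qed
  \<comment> \<open>On \<open>J\<close> the only nonempty level set is that of 0, so the diagonal
    part vanishes.\<close>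
  have \<phi>_J: "\<phi> \<alpha> = \<psi> \<alpha>" if "\<alpha> \<in> J" for \<alpha>
  proof -
    have "L k \<alpha> = (if k = 0 then UNIV else {})" for k
      using that by (auto simp: J_def L_def)
    then have "coeff (diag_sum (\<lambda>k. \<Lambda> (L k \<alpha>))) x y = 0" for x y
      by (auto simp: diag_sum.rep_eq \<Lambda>_empty \<Lambda>_UNIV intro!: sum.neutral split: if_splits)
    then have "diag_sum (\<lambda>k. \<Lambda> (L k \<alpha>)) = (0 :: ('a, 'k) FI)"
      by (intro FI_eqI) (simp add: zero_FI.rep_eq)
    then show ?thesis by (simp add: assms(10))
  qed
  have unit_\<phi>: "\<phi> \<alpha> \<in> unit_group \<longleftrightarrow> \<Lambda> (L 0 \<alpha>) = {}" for \<alpha>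
    by (simp add: unit_iff_L0_empty L_\<phi>)
  interpret \<phi>: Vector_Spaces.linear scale_FI scale_FI \<phi> by (rule assms(8))
  show ?thesis
  proof (intro iffI; elim conjE)
    assume bij: "bij \<phi>" and strong: "strong_invertibility_preserver \<phi>"
    have "A = {}" if "\<Lambda> A = {}" for A
    proof -
      \<comment> \<open>Every set A is the zero set of a diagonal element, so strongness can be
        tested on A.\<close>
      define \<alpha> :: "('a, 'k) FI" where "\<alpha> = diag (\<lambda>x. if x \<in> A then 0 else 1)"
      have L0: "L 0 \<alpha> = A" by (simp add: \<alpha>_def L_diag)
      then have "\<phi> \<alpha> \<in> unit_group" using that by (simp add: unit_\<phi>)
      then have "\<alpha> \<in> unit_group" using strong by (simp add: strong_invertibility_preserver_def)
      then show ?thesis using L0 by (simp add: unit_iff_L0_empty)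
    qed
    then have inj: "inj \<Lambda>" using boolean_endomorphism_inj[OF assms(2)] by simp
    have "B \<in> range \<Lambda>" for B
    proof -
      obtain \<alpha> where "\<phi> \<alpha> = diag (\<lambda>x. if x \<in> B then 1 else 0)"
        using bij by (metis bij_pointE)
      then have "\<Lambda> (L 1 \<alpha>) = B" using L_\<phi>[of 1 \<alpha>] by (auto simp: L_diag split: if_splits)
      then show ?thesis by blast
    qed
    then have "boolean_automorphism \<Lambda>"
      using inj assms(2) by (auto simp: boolean_automorphism_def bij_def)
    moreover have "J \<subseteq> \<psi> ` J"
    proof
      fix \<beta> :: "('a, 'k) FI" assume \<beta>: "\<beta> \<in> J"
      obtain \<alpha> where \<alpha>: "\<phi> \<alpha> = \<beta>" using bij by (metis bij_pointE)
      \<comment> \<open>Injectivity of \<Lambda> pulls membership in \<open>J\<close> back along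
        \<phi>.\<close>
      then have "\<Lambda> (L 0 \<alpha>) = \<Lambda> UNIV" using \<beta> L_\<phi>[of 0 \<alpha>] by (simp add: J_iff_L0 \<Lambda>_UNIV)
      then have "\<alpha> \<in> J" using inj by (simp add: J_iff_L0 inj_eq)
      then show "\<beta> \<in> \<psi> ` J" using \<alpha> \<phi>_J by auto
    qed
    moreover have "inj_on \<psi> J"
      using bij \<phi>_J by (metis (no_types, lifting) bij_is_inj inj_onI inj_eq)
    ultimately show "boolean_automorphism \<Lambda> \<and> bij_betw \<psi> J J"
      using \<psi>_J by (auto simp: bij_betw_def)
  next
    assume auto: "boolean_automorphism \<Lambda>" and \<psi>: "bij_betw \<psi> J J"
    then have bij\<Lambda>: "bij \<Lambda>" by (simp add: boolean_automorphism_def)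
    have \<Lambda>_eq: "\<Lambda> A = \<Lambda> B \<longleftrightarrow> A = B" for A B
      using bij\<Lambda> by (simp add: bij_is_inj inj_eq)
    have "\<alpha> = 0" if "\<phi> \<alpha> = 0" for \<alpha>
    proof -
      have "\<Lambda> (L 0 \<alpha>) = \<Lambda> UNIV" using L_\<phi>[of 0 \<alpha>] that by (simp add: L_zero \<Lambda>_UNIV)
      then have "\<alpha> \<in> J" by (simp add: \<Lambda>_eq J_iff_L0)
      moreover have "(0 :: ('a, 'k) FI) \<in> J" by (simp add: J_iff_L0 L_zero)
      moreover have "\<psi> \<alpha> = \<psi> 0"
        using \<open>\<alpha> \<in> J\<close> \<open>0 \<in> J\<close> \<phi>_J that \<phi>.zero by metis
      ultimately show ?thesis using \<psi> by (auto simp: bij_betw_def inj_on_def)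
    qed
    then have "inj \<phi>" by (simp add: \<phi>.inj_iff_eq_0)
    moreover have "\<beta> \<in> range \<phi>" for \<beta>
    proof -
      \<comment> \<open>Pulling the level sets of \<beta> back along \<Lambda> gives a partition,
        and \<open>diag_sum B\<close> is then mapped to an element with the diagonal of \<beta>. The
        remaining error lies in \<open>J\<close> and is supplied by \<psi>.\<close>
      define B where "B k = inv \<Lambda> (L k \<beta>)" for k
      have \<Lambda>B: "\<Lambda> (B k) = L k \<beta>" for k
        using bij\<Lambda> by (simp add: B_def bij_is_surj surj_f_inv_f)
      have "B k \<inter> B j = {}" if "k \<noteq> j" for k j
      proof -
        have "\<Lambda> (B k \<inter> B j) = \<Lambda> {}" using that by (auto simp: \<Lambda>_Int \<Lambda>B \<Lambda>_empty L_def)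
        then show ?thesis by (simp only: \<Lambda>_eq)
      qed
      then have B_disj: "disjoint_family B" by (auto simp: disjoint_family_on_def)
      have "\<Lambda> (\<Union>k. B k) = \<Lambda> UNIV"
        by (auto simp: complete_map_Union_range[OF assms(3)] \<Lambda>B \<Lambda>_UNIV L_def)
      then have B_cover: "(\<Union>k. B k) = UNIV" by (simp only: \<Lambda>_eq)
      have "\<beta> - \<phi> (diag_sum B) \<in> J"
        unfolding diff_in_J_iff by (simp add: L_\<phi> L_diag_sum[OF B_disj B_cover] \<Lambda>B)
      then obtain \<gamma> where "\<gamma> \<in> J" "\<beta> - \<phi> (diag_sum B) = \<psi> \<gamma>"
        using \<psi> by (auto simp: bij_betw_def)
      then have "\<beta> = \<phi> (diag_sum B + \<gamma>)" by (simp add: \<phi>.add \<phi>_J algebra_simps)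
      then show ?thesis by blast
    qed
    ultimately have "bij \<phi>" by (auto simp: bij_def)
    moreover have "\<phi> \<alpha> \<in> unit_group \<longleftrightarrow> \<alpha> \<in> unit_group" for \<alpha>
      using \<Lambda>_eq[of "L 0 \<alpha>" "{}"] by (simp add: unit_\<phi> unit_iff_L0_empty[of \<alpha>] \<Lambda>_empty)
    ultimately show "bij \<phi> \<and> strong_invertibility_preserver \<phi>"
      using assms(9) by (simp add: strong_invertibility_preserver_def)
  qed
qed

end
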